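(* Let $n\ge k\ge1$ be integers, and let $M^{(\ell)}_{n,k}$ (resp. $M^{(c)}_{n,k}$) denote the maximum value of $\mathrm{cr}^{(\ell)}(\pi)$ (resp. $\mathrm{cr}^{(c)}(\pi)$) taken over all $\pi\in\Pi_n^k$. Then: (1) (a) if $1\le k\le\lfloor n/2\rfloor$, then $M^{(\ell)}_{n,k}=(k-1)n-3\binom k2$; (b) if $\lceil n/2\rceil\le k\le n$, then $M^{(\ell)}_{n,k}=\binom{n-k}{2}$; (2) (a) if $k\le\frac n3$, then $M^{(c)}_{n,k}=2\binom k2\left\lfloor\frac nk\right\rfloor+2\binom r2=(k-1)n-r(k-r)$, where $r$ is the remainder in the division of $n$ by $k$; (b) if $\frac n3\le k<\frac n2$ or $\frac n2\le k\le n-6$, then, with $a=n-k$, $M^{(c)}_{n,k}=6\binom{\lfloor a/2\rfloor}{2}+2\lfloor a/2\rfloor\,\chi(a\equiv1\pmod 2)$; (c) if $k\ge n-5$ and $k\ge\frac n2$, then $M^{(c)}_{n,k}=\binom{n-k}{2}$.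
   Context: $\Pi_n^k$ is the set of all partitions of $[n]=\{1,\dots,n\}$ into $k$ (nonempty) blocks. $\chi(P)=1$ if $P$ is true and $0$ otherwise. For a set partition $\pi$ of $[n]$: the arcs of its linear representation are the pairs $(i,j)$, $i<j$, where $i,j$ are consecutive elements (in increasing order) of the same block. $\mathrm{cr}^{(\ell)}(\pi)$ is the number of (unordered) pairs of crossing arcs, i.e. pairs of arcs $(i,j),(i',j')$ with $i<i'<j<j'$. The chords of its circular representation are obtained by placing $1,\dots,n$ in order on a circle and drawing each block as the convex polygon on its elements: a block $\{b_1<\dots<b_m\}$ contributes no chord if $m=1$, the single chord $\{b_1,b_2\}$ if $m=2$, and the $m$ chords $\{b_1,b_2\},\dots,\{b_{m-1},b_m\},\{b_1,b_m\}$ if $m\ge3$. $\mathrm{cr}^{(c)}(\pi)$ is the number of (unordered) pairs of crossing chords, i.e. pairs of chords $\{i,j\},\{i',j'\}$ with $i<i'<j<j'$. *)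

theory Defs
  imports Complex_Main "HOL-Library.Disjoint_Sets"
begin

definition set_partitions :: "nat \<Rightarrow> nat \<Rightarrow> nat set set set" where
  "set_partitions n k = {P. partition_on {1..n} P \<and> card P = k}"

text \<open>Arcs and chords are represented by the pair of their endpoints with the smaller one first.\<close>

definition arcs :: "nat set set \<Rightarrow> (nat \<times> nat) set" where
  "arcs P = {(i, j). \<exists>B\<in>P. i \<in> B \<and> j \<in> B \<and> i < j \<and> (\<forall>m\<in>B. \<not> (i < m \<and> m < j))}"

text \<open>The sides of the convex polygon on a block are the arcs of the block together with the
  closing side, which is a further chord only if the block has at least three elements.\<close>

definition chords :: "nat set set \<Rightarrow> (nat \<times> nat) set" where
  "chords P = arcs P \<union> {(Min B, Max B) | B. B \<in> P \<and> card B \<ge> 3}"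

text \<open>The condition \<open>i < i' < j < j'\<close> is asymmetric in the two pairs, so every unordered
  crossing pair is counted exactly once.\<close>

definition crossings :: "(nat \<times> nat) set \<Rightarrow> nat" where
  "crossings A =
     card {((i, j), (i', j')). (i, j) \<in> A \<and> (i', j') \<in> A \<and> i < i' \<and> i' < j \<and> j < j'}"

definition cr_linear :: "nat set set \<Rightarrow> nat" where
  "cr_linear P = crossings (arcs P)"

definition cr_circular :: "nat set set \<Rightarrow> nat" where
  "cr_circular P = crossings (chords P)"

definition max_cr_linear :: "nat \<Rightarrow> nat \<Rightarrow> nat" where
  "max_cr_linear n k = Max (cr_linear ` set_partitions n k)"

definition max_cr_circular :: "nat \<Rightarrow> nat \<Rightarrow> nat" where
  "max_cr_circular n k = Max (cr_circular ` set_partitions n k)"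

text \<open>The two maxima are taken over a finite set, which is nonempty for \<open>1 \<le> k \<le> n\<close>.\<close>

lemma finite_set_partitions: "finite (set_partitions n k)"
proof (rule finite_subset)
  show "set_partitions n k \<subseteq> Pow (Pow {1..n})"
    by (auto simp: set_partitions_def partition_on_def)
qed simp

lemma set_partitions_nonempty:
  assumes "1 \<le> k" "k \<le> n"
  shows "set_partitions n k \<noteq> {}"
proof -
  let ?S = "(\<lambda>i. {i}) ` {1..<k}"
  have "partition_on {1..n} (insert {k..n} ?S)"
    using assms by (auto simp: partition_on_def disjoint_def)
  moreover have "card (insert {k..n} ?S) = k"
  proof -
    have "{k..n} \<notin> ?S"
    proof
      assume "{k..n} \<in> ?S"
      then obtain i where i: "i < k" "{k..n} = {i}" by auto
      have "k \<in> {k..n}" using assms by simp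
      then show False using i by simp
    qed
    moreover have "card ?S = k - 1" by (simp add: card_image)
    ultimately show ?thesis using assms by simp
  qed
  ultimately show ?thesis by (auto simp: set_partitions_def)
qed

end

theory Submission
  imports Defs
begin

text \<open>
  Both maxima come from one principle: two blocks of given sizes can have only so many crossings
  with each other, and there is a partition in which all pairs of blocks reach their bound at once.

  \<^emph>\<open>Upper bounds.\<close> Chords of the same block never cross, so the crossing number is a sum over pairs
  of blocks. In the linear representation, two blocks of sizes \<open>s, t \<ge> 2\<close> cross at most
  \<open>s + t - 3\<close> times: a crossing is determined by the smaller of its two right endpoints, and this
  point is neither the least element of a block nor the largest element of all
  (\<open>card_meeting_arcs_le\<close>). A singleton has no arcs. If \<open>m\<close> blocks are not singletons and
  \<open>a = n - k\<close> is the total excess \<open>\<Sum>(s - 1)\<close>, the sum over all pairs is \<open>(m - 1) (2 a - m) / 2\<close>;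
  this grows with \<open>m\<close> up to the largest possible value \<open>min k a\<close>.

  In the circular representation, a segment with endpoints outside a convex polygon meets at most
  two of its sides (\<open>card_chords_meeting_segment_le\<close>), so two blocks cross at most twice the number
  of chords of either one. This is used in two ways. It gives the bound \<open>2 min s t\<close>, and
  the sum of these minima is largest when the sizes are as equal as possible
  (\<open>sum_min_le_square\<close>). It also shows that a block of excess \<open>2 h + d\<close> with \<open>d \<le> 1\<close> has no
  more crossings with the other blocks than \<open>h\<close> triangles and \<open>d\<close> segments can have
  (\<open>card_meeting_chords_le_pieces\<close>). With \<open>H\<close> triangles in total, the remaining excess
  \<open>a - 2 H\<close> being spent on segments, these pieces have at most
  \<open>6 (H choose 2) + 2 H (a - 2 H) + ((a - 2 H) choose 2) = (a choose 2) + H (H - 2)\<close> crossings.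
  Hence it is best to use as many triangles as possible, except that for \<open>a \<le> 5\<close> one cannot do
  better than to use none, provided that there are enough blocks for \<open>a\<close> segments.

  \<^emph>\<open>Constructions.\<close> The extremal partitions are the residue classes modulo \<open>m\<close> on an initial
  segment \<open>{1..N}\<close>, followed by singletons. The arcs are all \<open>(x, x + m)\<close>, and the closing sides
  join the first \<open>m\<close> points to the last \<open>m\<close> points, so that the crossings can be counted
  (\<open>crossings_ge\<close>). For triangles and at most one segment one takes for \<open>m\<close> their number and for
  \<open>N\<close> the number of their vertices; in all other cases \<open>m = k\<close> and \<open>N = n\<close>.
\<close>

section \<open>Pairs of chords that cross\<close>

text \<open>The symmetric form of crossing. Counting ordered pairs counts every crossing twice, but it
  makes the roles of the two chords, and later of the two blocks, interchangeable.\<close>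
definition meets :: "nat \<times> nat \<Rightarrow> nat \<times> nat \<Rightarrow> bool" where
  "meets e f \<longleftrightarrow> (fst e < fst f \<and> fst f < snd e \<and> snd e < snd f) \<or>
                 (fst f < fst e \<and> fst e < snd f \<and> snd f < snd e)"

definition meeting :: "(nat \<times> nat) set \<Rightarrow> (nat \<times> nat) set \<Rightarrow> ((nat \<times> nat) \<times> (nat \<times> nat)) set" where
  "meeting E F = {(e, f) \<in> E \<times> F. meets e f}"

lemma meets_sym: "meets e f \<longleftrightarrow> meets f e"
  by (auto simp: meets_def)

lemma meeting_subset: "meeting E F \<subseteq> E \<times> F"
  by (auto simp: meeting_def)

lemma finite_meeting: "finite E \<Longrightarrow> finite F \<Longrightarrow> finite (meeting E F)"
  by (rule finite_subset[OF meeting_subset]) simp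

lemma twice_crossings:
  assumes "finite A"
  shows "2 * crossings A = card (meeting A A)"
proof -
  let ?C = "{((i, j), (i', j')). (i, j) \<in> A \<and> (i', j') \<in> A \<and> i < i' \<and> i' < j \<and> j < j'}"
  have split: "meeting A A = ?C \<union> prod.swap ` ?C"
  proof (intro equalityI subsetI)
    fix p assume "p \<in> meeting A A"
    then obtain i j i' j' where p: "p = ((i, j), (i', j'))" "(i, j) \<in> A" "(i', j') \<in> A"
      "meets (i, j) (i', j')"
      by (auto simp: meeting_def)
    then consider "p \<in> ?C" | "((i', j'), (i, j)) \<in> ?C" by (auto simp: meets_def)
    then show "p \<in> ?C \<union> prod.swap ` ?C"
    proof cases
      case 2
      then have "prod.swap ((i', j'), (i, j)) \<in> prod.swap ` ?C" by (rule imageI)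
      then show ?thesis using p by simp
    qed simp
  qed (auto simp: meeting_def meets_def)
  have fin: "finite ?C"
    by (rule finite_subset[of _ "A \<times> A"]) (use assms in auto)
  have "card (meeting A A) = card ?C + card (prod.swap ` ?C)"
    unfolding split by (rule card_Un_disjoint) (use fin in auto)
  also have "card (prod.swap ` ?C) = card ?C"
    by (rule card_image) (simp add: inj_on_def)
  finally show ?thesis by (simp add: crossings_def)
qed

text \<open>As the chords of one block do not cross each other, every crossing lies between
  two different blocks, and bounds for pairs of blocks add up. The function \<open>E\<close> is
  instantiated with the arcs and with the chords of a block.\<close>
lemma twice_crossings_le:
  fixes w :: "nat set \<Rightarrow> nat set \<Rightarrow> int"
  assumes fin: "finite P" "\<And>B. B \<in> P \<Longrightarrow> finite (E B)"
    and self: "\<And>B. B \<in> P \<Longrightarrow> meeting (E B) (E B) = {}"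
    and le: "\<And>B C. B \<in> P \<Longrightarrow> C \<in> P \<Longrightarrow> B \<noteq> C \<Longrightarrow> int (card (meeting (E B) (E C))) \<le> w B C"
  shows "2 * int (crossings (\<Union>B\<in>P. E B)) \<le> (\<Sum>B\<in>P. \<Sum>C\<in>P - {B}. w B C)"
proof -
  let ?A = "\<Union>B\<in>P. E B"
  have "meeting ?A ?A \<subseteq> (\<Union>B\<in>P. \<Union>C\<in>P - {B}. meeting (E B) (E C))"
  proof
    fix p assume "p \<in> meeting ?A ?A"
    then obtain e f B C where p: "p = (e, f)" "B \<in> P" "C \<in> P" "e \<in> E B" "f \<in> E C" "meets e f"
      by (auto simp: meeting_def)
    then have "p \<in> meeting (E B) (E C)" by (simp add: meeting_def)
    moreover from this have "B \<noteq> C" using self p by auto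
    ultimately show "p \<in> (\<Union>B\<in>P. \<Union>C\<in>P - {B}. meeting (E B) (E C))" using p by blast
  qed
  then have "card (meeting ?A ?A) \<le> card (\<Union>B\<in>P. \<Union>C\<in>P - {B}. meeting (E B) (E C))"
    by (rule card_mono[rotated]) (use fin in \<open>auto intro!: finite_meeting\<close>)
  also have "\<dots> \<le> (\<Sum>B\<in>P. card (\<Union>C\<in>P - {B}. meeting (E B) (E C)))"
    by (rule card_UN_le) (rule fin)
  also have "\<dots> \<le> (\<Sum>B\<in>P. \<Sum>C\<in>P - {B}. card (meeting (E B) (E C)))"
    by (intro sum_mono card_UN_le) (use fin in auto)
  finally have "int (card (meeting ?A ?A)) \<le> (\<Sum>B\<in>P. \<Sum>C\<in>P - {B}. int (card (meeting (E B) (E C))))"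
    by (metis (no_types, lifting) of_nat_sum of_nat_le_iff sum.cong)
  also have "\<dots> \<le> (\<Sum>B\<in>P. \<Sum>C\<in>P - {B}. w B C)"
    by (intro sum_mono le) auto
  finally show ?thesis
    using twice_crossings[of ?A] fin by (simp flip: of_nat_mult)
qed

section \<open>Arcs and chords of a partition, block by block\<close>

lemma arcs_Union: "arcs P = (\<Union>B\<in>P. arcs {B})"
  by (auto simp: arcs_def)

lemma chords_Union: "chords P = (\<Union>B\<in>P. chords {B})"
  by (auto simp: chords_def arcs_def)

lemma arc_iff: "(i, j) \<in> arcs {B} \<longleftrightarrow> i \<in> B \<and> j \<in> B \<and> i < j \<and> (\<forall>m\<in>B. \<not> (i < m \<and> m < j))"
  by (auto simp: arcs_def)

lemma chord_iff: "e \<in> chords {B} \<longleftrightarrow> e \<in> arcs {B} \<or> (3 \<le> card B \<and> e = (Min B, Max B))"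
  by (auto simp: chords_def)

lemma arcs_subset: "arcs {B} \<subseteq> B \<times> B"
  by (auto simp: arcs_def)

lemma finite_arcs: "finite B \<Longrightarrow> finite (arcs {B})"
  by (rule finite_subset[OF arcs_subset]) simp

lemma finite_chords: "finite B \<Longrightarrow> finite (chords {B})"
  by (rule finite_subset[of _ "insert (Min B, Max B) (arcs {B})"])
     (auto simp: chord_iff finite_arcs)

lemma arcs_no_self_crossing: "meeting (arcs {B}) (arcs {B}) = {}"
  by (fastforce simp: meeting_def meets_def arc_iff)

text \<open>The closing side joins the extreme elements of the block, and nothing in the block lies
  outside them.\<close>
lemma chords_no_self_crossing:
  assumes "finite B"
  shows "meeting (chords {B}) (chords {B}) = {}"
proof -
  have b: "Min B \<le> x" "x \<le> Max B" if "x \<in> B" for x using assms that by auto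
  have "\<not> meets e f" if e: "e \<in> chords {B}" and f: "f \<in> chords {B}" for e f
  proof -
    have ne: "B \<noteq> {}" using e by (auto simp: chord_iff arcs_def)
    have in_B: "fst g \<in> B \<and> snd g \<in> B" if "g \<in> chords {B}" for g
      using that Min_in[OF assms ne] Max_in[OF assms ne] by (auto simp: chord_iff arcs_def)
    consider "e \<in> arcs {B}" "f \<in> arcs {B}" | "e = (Min B, Max B)" | "f = (Min B, Max B)"
      using e f by (auto simp: chord_iff)
    then show ?thesis
    proof cases
      case 1
      moreover have "(e, f) \<notin> meeting (arcs {B}) (arcs {B})" by (simp add: arcs_no_self_crossing)
      ultimately show ?thesis by (simp add: meeting_def)
    next
      case 2
      then show ?thesis using b[of "fst f"] b[of "snd f"] in_B[OF f] by (auto simp: meets_def)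
    next
      case 3
      then show ?thesis using b[of "fst e"] b[of "snd e"] in_B[OF e] by (auto simp: meets_def)
    qed
  qed
  then show ?thesis by (auto simp: meeting_def)
qed

text \<open>The arcs of a block cover the interval between its extreme elements
  without overlapping.\<close>
lemma arc_over_unique:
  assumes "e \<in> arcs {B}" "f \<in> arcs {B}" "fst e < x" "x < snd e" "fst f < x" "x < snd f"
  shows "e = f"
proof -
  have e: "fst e \<in> B" "snd e \<in> B" "\<forall>m\<in>B. \<not> (fst e < m \<and> m < snd e)"
    and f: "fst f \<in> B" "snd f \<in> B" "\<forall>m\<in>B. \<not> (fst f < m \<and> m < snd f)"
    using assms(1,2) by (auto simp: arcs_def)
  have "fst e = fst f"
    using e(3)[rule_format, OF f(1)] f(3)[rule_format, OF e(1)] assms by linarith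
  moreover have "snd e = snd f"
    using e(3)[rule_format, OF f(2)] f(3)[rule_format, OF e(2)] assms by linarith
  ultimately show ?thesis by (simp add: prod_eq_iff)
qed

lemma arc_to_unique:
  assumes "e \<in> arcs {B}" "f \<in> arcs {B}" "snd e = snd f"
  shows "e = f"
proof -
  have e: "fst e \<in> B" "fst e < snd e" "\<forall>m\<in>B. \<not> (fst e < m \<and> m < snd e)"
    and f: "fst f \<in> B" "fst f < snd f" "\<forall>m\<in>B. \<not> (fst f < m \<and> m < snd f)"
    using assms(1,2) by (auto simp: arcs_def)
  have "fst e = fst f"
    using e(3)[rule_format, OF f(1)] f(3)[rule_format, OF e(1)] assms e f by linarith
  then show ?thesis using assms(3) by (simp add: prod_eq_iff)
qed

lemma arcs_singleton: 
  assumes "card B = 1" shows "arcs {B} = {}"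
  using assms by (auto simp: card_1_singleton_iff arcs_def)

lemma chords_small: "card B \<le> 2 \<Longrightarrow> chords {B} = arcs {B}"
  by (auto simp: chord_iff)

lemma card_arcs_le:
  assumes "finite B" "B \<noteq> {}"
  shows "card (arcs {B}) \<le> card B - 1"
proof -
  have "card (arcs {B}) = card (snd ` arcs {B})"
    by (rule card_image[symmetric]) (auto intro!: inj_onI dest: arc_to_unique)
  also have "\<dots> \<le> card (B - {Min B})"
  proof (rule card_mono)
    show "snd ` arcs {B} \<subseteq> B - {Min B}"
    proof
      fix j assume "j \<in> snd ` arcs {B}"
      then obtain i where "i \<in> B" "j \<in> B" "i < j" by (auto simp: arcs_def)
      moreover have "Min B \<le> i" using \<open>i \<in> B\<close> assms by simp
      ultimately show "j \<in> B - {Min B}" by auto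
    qed
  qed (use assms in simp)
  also have "\<dots> = card B - 1" using assms by simp
  finally show ?thesis .
qed

text \<open>A block of two elements has one chord and not two, as its closing side is its only arc.\<close>
lemma card_chords_le:
  assumes "finite B" "B \<noteq> {}"
  shows "card (chords {B}) \<le> (if card B \<le> 2 then card B - 1 else card B)"
proof (cases "card B \<le> 2")
  case True
  then show ?thesis using chords_small card_arcs_le[OF assms] by simp
next
  case False
  have "chords {B} \<subseteq> insert (Min B, Max B) (arcs {B})" by (auto simp: chord_iff)
  then have "card (chords {B}) \<le> card (insert (Min B, Max B) (arcs {B}))"
    by (rule card_mono[rotated]) (simp add: finite_arcs assms)
  also have "\<dots> \<le> Suc (card (arcs {B}))" by (rule card_insert_le_m1) auto
  finally show ?thesis using False card_arcs_le[OF assms] by simp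
qed

section \<open>Crossings between two blocks\<close>

text \<open>A crossing is determined by the smaller of its right endpoints: this is the right
  end of a unique arc of its own block, and it lies below a unique arc of the other block. The
  three excluded points, that is, the two minima and the overall maximum, are distinct because
  both blocks have at least two elements.\<close>
lemma card_meeting_arcs_le:
  assumes fin: "finite B" "finite C" and disj: "B \<inter> C = {}"
    and ge: "2 \<le> card B" "2 \<le> card C"
  shows "card (meeting (arcs {B}) (arcs {C})) \<le> card B + card C - 3"
proof -
  let ?M = "meeting (arcs {B}) (arcs {C})"
  let ?f = "\<lambda>(e, f). min (snd e) (snd f :: nat)"
  have ne: "B \<noteq> {}" "C \<noteq> {}" using ge by auto
  define b c z where "b = Min B" and "c = Min C" and "z = Max (B \<union> C)"
  have mn: "b \<in> B" "c \<in> C" using fin ne by (simp_all add: b_def c_def)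
  have zin: "z \<in> B \<union> C" unfolding z_def by (rule Max_in) (use fin ne in auto)
  have bd: "\<And>x. x \<in> B \<Longrightarrow> b \<le> x \<and> x \<le> z" "\<And>x. x \<in> C \<Longrightarrow> c \<le> x \<and> x \<le> z"
    using fin ne by (auto simp: b_def c_def z_def intro: Max_ge)
  \<comment> \<open>If \<open>z\<close> were a minimum, its block would have no other element.\<close>
  have second: "\<exists>y\<in>D. y \<noteq> x" if "2 \<le> card D" "finite D" for D :: "nat set" and x
  proof (rule ccontr)
    assume "\<not> ?thesis"
    then have "D \<subseteq> {x}" by auto
    then have "card D \<le> 1" using card_mono[of "{x}" D] by simp
    then show False using that by simp
  qed
  have "z \<noteq> b" using second[OF ge(1) fin(1), of b] bd by (metis le_antisym)
  moreover have "z \<noteq> c" using second[OF ge(2) fin(2), of c] bd by (metis le_antisym)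
  moreover have "b \<noteq> c" using mn disj by auto
  ultimately have "card {b, c, z} = 3" by auto
  then have cd: "card (B \<union> C - {b, c, z}) = card B + card C - 3"
    using mn zin fin disj by (subst card_Diff_subset) (auto simp: card_Un_disjoint)
  have D: "i \<in> B" "j \<in> B" "i < j" "i' \<in> C" "j' \<in> C" "i' < j'" "j \<noteq> j'" "meets (i, j) (i', j')"
    "(i, j) \<in> arcs {B}" "(i', j') \<in> arcs {C}"
    if "((i, j), (i', j')) \<in> ?M" for i j i' j'
    using that disj by (auto simp: meeting_def arc_iff)
  have "inj_on ?f ?M"
  proof (rule inj_onI)
    fix p q assume p: "p \<in> ?M" and q: "q \<in> ?M" and eq: "?f p = ?f q"
    obtain i j i' j' where P: "p = ((i, j), (i', j'))" by (metis surj_pair)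
    obtain u v u' v' where Q: "q = ((u, v), (u', v'))" by (metis surj_pair)
    note dp = D[OF p[unfolded P]] and dq = D[OF q[unfolded Q]]
    have eq': "min j j' = min v v'" using eq by (simp add: P Q)
    have x: "j \<noteq> v'" "v \<noteq> j'" using dp dq disj by auto
    show "p = q"
    proof (cases "j < j'")
      case True
      then have "j = v" "v < v'" using eq' x by (auto simp: min_def split: if_splits)
      moreover have "(i, j) = (u, v)" using arc_to_unique[OF dp(9) dq(9)] \<open>j = v\<close> by simp
      moreover have "(i', j') = (u', v')"
        by (rule arc_over_unique[OF dp(10) dq(10), of j])
          (use dp(8) dq(8) True \<open>j = v\<close> \<open>v < v'\<close> in \<open>auto simp: meets_def\<close>)
      ultimately show ?thesis by (simp add: P Q)
    next
      case False
      then have "j' < j" using dp by simp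
      then have "j' = v'" "v' < v" using eq' x dq(7) by (auto simp: min_def split: if_splits)
      moreover have "(i', j') = (u', v')" using arc_to_unique[OF dp(10) dq(10)] \<open>j' = v'\<close> by simp
      moreover have "(i, j) = (u, v)"
        by (rule arc_over_unique[OF dp(9) dq(9), of j'])
          (use dp(8) dq(8) \<open>j' < j\<close> \<open>j' = v'\<close> \<open>v' < v\<close> in \<open>auto simp: meets_def\<close>)
      ultimately show ?thesis by (simp add: P Q)
    qed
  qed
  moreover have "?f ` ?M \<subseteq> B \<union> C - {b, c, z}"
  proof
    fix y assume "y \<in> ?f ` ?M"
    then obtain i j i' j' where M: "((i, j), (i', j')) \<in> ?M" and y: "y = min j j'" by auto
    note d = D[OF M]
    have "b \<le> i" "c \<le> i'" "j \<le> z" "j' \<le> z" using d bd by auto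
    moreover have "i < y" "i' < y" "y < max j j'" using d y by (auto simp: meets_def)
    ultimately show "y \<in> B \<union> C - {b, c, z}" using d y by (auto simp: min_def max_def)
  qed
  ultimately show ?thesis
    using card_inj_on_le[of ?f ?M "B \<union> C - {b, c, z}"] fin cd by simp
qed

text \<open>A line meets the boundary of a convex polygon at most twice. In terms of chords, a side
  crossing \<open>(u, v)\<close> is the arc over \<open>u\<close>, the arc over \<open>v\<close> or the closing side. If the closing side
  crosses, then one of \<open>u, v\<close> lies outside the range of the block, and no arc passes over it.\<close>
lemma card_chords_meeting_segment_le:
  assumes fin: "finite C" and out: "u \<notin> C" "v \<notin> C"
  shows "card {f \<in> chords {C}. meets (u, v) f} \<le> 2"
proof -
  define over where "over x = {f \<in> arcs {C}. fst f < x \<and> x < snd f}" for x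
  let ?K = "{f \<in> chords {C}. meets (u, v) f}"
  have one: "card (over x) \<le> 1" "finite (over x)" for x
  proof -
    show "finite (over x)" by (simp add: over_def finite_arcs fin)
    show "card (over x) \<le> 1"
      unfolding One_nat_def by (subst card_le_Suc0_iff_eq)
        (use finite_arcs[OF fin] in \<open>auto simp: over_def dest: arc_over_unique simp del: split_paired_All\<close>)
  qed
  have sub: "?K \<subseteq> insert (Min C, Max C) (over u \<union> over v)"
    by (auto simp: chord_iff over_def meets_def)
  have leq: "card ?K \<le> card X + card Y" if "?K \<subseteq> X \<union> Y" "finite X" "finite Y" for X Y
    using card_mono[OF _ that(1)] card_Un_le[of X Y] that by simp
  show ?thesis
  proof (cases "(Min C, Max C) \<in> ?K")
    case False
    then have "?K \<subseteq> over u \<union> over v" using sub by blast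
    from leq[OF this] show ?thesis using one[of u] one[of v] by simp
  next
    case True
    have b: "Min C \<le> x" "x \<le> Max C" if "x \<in> C" for x using fin that by auto
    from True have "Max C < v \<or> u < Min C" by (auto simp: meets_def)
    then have "over v = {} \<or> over u = {}"
      using b by (fastforce simp: over_def arcs_def)
    then obtain x where "?K \<subseteq> {(Min C, Max C)} \<union> over x" using sub by blast
    from leq[OF this] show ?thesis using one[of x] by simp
  qed
qed

lemma card_meeting_chords_le:
  assumes fin: "finite B" "finite C" and ne: "B \<noteq> {}" and disj: "B \<inter> C = {}"
  shows "card (meeting (chords {B}) (chords {C})) \<le> 2 * card (chords {B})"
proof -
  have "meeting (chords {B}) (chords {C}) = (SIGMA e:chords {B}. {f \<in> chords {C}. meets e f})"
    by (auto simp: meeting_def)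
  then have "card (meeting (chords {B}) (chords {C})) = (\<Sum>e\<in>chords {B}. card {f \<in> chords {C}. meets e f})"
    by (simp add: card_SigmaI finite_chords fin)
  also have "\<dots> \<le> (\<Sum>e\<in>chords {B}. 2)"
  proof (rule sum_mono)
    fix e assume e: "e \<in> chords {B}"
    have "fst e \<in> B \<and> snd e \<in> B"
      using e Min_in[OF fin(1) ne] Max_in[OF fin(1) ne] by (auto simp: chord_iff arcs_def)
    then show "card {f \<in> chords {C}. meets e f} \<le> 2"
      using card_chords_meeting_segment_le[OF fin(2), of "fst e" "snd e"] disj by auto
  qed
  finally show ?thesis by simp
qed

lemma card_meeting_sym: "card (meeting E F) = card (meeting F E)"
proof -
  have "meeting E F = prod.swap ` meeting F E"
    by (force simp: meeting_def meets_sym)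
  then show ?thesis by (simp add: card_image)
qed

section \<open>Upper bounds over all partitions\<close>

lemma set_partitionsD:
  assumes "P \<in> set_partitions n k"
  shows "finite P" "card P = k" "(\<Sum>B\<in>P. int (card B)) = int n"
    and "B \<in> P \<Longrightarrow> finite B" "B \<in> P \<Longrightarrow> B \<noteq> {}" "B \<in> P \<Longrightarrow> 0 < card B"
    and "B \<in> P \<Longrightarrow> C \<in> P \<Longrightarrow> B \<noteq> C \<Longrightarrow> B \<inter> C = {}"
proof -
  have P: "partition_on {1..n} P" and k: "card P = k"
    using assms by (auto simp: set_partitions_def)
  have U: "\<Union>P = {1..n}" and d: "disjoint P" and "{} \<notin> P"
    using P by (auto simp: partition_on_def)
  show "finite P" using P by (rule finite_elements[rotated]) simp
  show fB: "finite B" if "B \<in> P" for B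
    using that U by (metis Union_upper finite_atLeastAtMost finite_subset)
  show ne: "B \<noteq> {}" if "B \<in> P" for B using that \<open>{} \<notin> P\<close> by auto
  show "B \<in> P \<Longrightarrow> 0 < card B" using fB ne by (simp add: card_gt_0_iff)
  show "B \<in> P \<Longrightarrow> C \<in> P \<Longrightarrow> B \<noteq> C \<Longrightarrow> B \<inter> C = {}" using d by (auto simp: disjoint_def)
  show "card P = k" by (rule k)
  have "card (\<Union>P) = (\<Sum>B\<in>P. card B)"
    by (rule card_Union_disjoint) (use d fB in \<open>auto simp: disjoint_def pairwise_def disjnt_def\<close>)
  then show "(\<Sum>B\<in>P. int (card B)) = int n" using U by (simp flip: of_nat_sum)
qed

lemma off_diagonal_sum:
  fixes w :: "'a \<Rightarrow> 'a \<Rightarrow> int"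
  assumes "finite P"
  shows "(\<Sum>B\<in>P. \<Sum>C\<in>P - {B}. w B C) = (\<Sum>B\<in>P. \<Sum>C\<in>P. w B C) - (\<Sum>B\<in>P. w B B)"
proof -
  have "(\<Sum>B\<in>P. \<Sum>C\<in>P - {B}. w B C) = (\<Sum>B\<in>P. (\<Sum>C\<in>P. w B C) - w B B)"
    by (rule sum.cong) (use assms in \<open>auto simp: sum_diff1\<close>)
  then show ?thesis by (simp add: sum_subtractf)
qed

lemma sum_excess:
  assumes "P \<in> set_partitions n k"
  shows "(\<Sum>B\<in>P. int (card B - 1)) = int n - int k"
proof -
  have "(\<Sum>B\<in>P. int (card B - 1)) = (\<Sum>B\<in>P. int (card B) - 1)"
    by (rule sum.cong) (use set_partitionsD(6)[OF assms] in \<open>auto simp: of_nat_diff Suc_leI\<close>)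
  then show ?thesis using set_partitionsD(2,3)[OF assms] by (simp add: sum_subtractf)
qed

text \<open>Here \<open>m\<close> is the number of blocks that are not singletons. With the excess \<open>x\<close> of a block
  and the indicator \<open>q\<close> of not being a singleton, the bound for two blocks is
  \<open>x B + x C - 1\<close>, and it must become \<open>0\<close> when one of them is a singleton. As \<open>x\<close> vanishes on
  singletons, the form \<open>x B * q C + q B * x C - q B * q C\<close> achieves this and can be summed as
  products.\<close>
lemma cr_linear_le:
  assumes P: "P \<in> set_partitions n k"
  obtains m where "m \<le> k" "int m \<le> int n - int k"
    "2 * int (cr_linear P) \<le> (int m - 1) * (2 * (int n - int k) - int m)"
proof -
  note D = set_partitionsD[OF P]
  define x where "x B = int (card B - 1)" for B :: "nat set"
  define q where "q B = (of_bool (2 \<le> card B) :: int)" for B :: "nat set"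
  define m where "m = card {B \<in> P. 2 \<le> card B}"
  let ?a = "int n - int k"
  have sx: "(\<Sum>B\<in>P. x B) = ?a" using sum_excess[OF P] by (simp add: x_def)
  have sq: "(\<Sum>B\<in>P. q B) = int m"
    using D(1) by (simp add: q_def m_def Int_def conj_commute flip: Collect_conj_eq)
  have "m \<le> k" unfolding m_def using card_mono[of P "{B \<in> P. 2 \<le> card B}"] D by auto
  have "int m \<le> ?a" unfolding sx[symmetric] sq[symmetric]
    by (rule sum_mono) (auto simp: q_def x_def)
  have "2 * int (cr_linear P) \<le> (\<Sum>B\<in>P. \<Sum>C\<in>P - {B}. x B * q C + q B * x C - q B * q C)"
    unfolding cr_linear_def arcs_Union[of P]
  proof (rule twice_crossings_le)
    fix B C assume BC: "B \<in> P" "C \<in> P" "B \<noteq> C"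
    consider "2 \<le> card B" "2 \<le> card C" | "card B = 1" | "card C = 1"
      using D(6)[OF BC(1)] D(6)[OF BC(2)] by linarith
    then show "int (card (meeting (arcs {B}) (arcs {C}))) \<le> x B * q C + q B * x C - q B * q C"
    proof cases
      case 1
      then show ?thesis
        using card_meeting_arcs_le[OF D(4)[OF BC(1)] D(4)[OF BC(2)] D(7)[OF BC]]
        by (simp add: x_def q_def of_nat_diff)
    qed (simp_all add: arcs_singleton meeting_def x_def q_def)
  qed (use D in \<open>auto simp: finite_arcs arcs_no_self_crossing\<close>)
  also have "\<dots> = (\<Sum>B\<in>P. \<Sum>C\<in>P. x B * q C + q B * x C - q B * q C)
      - (\<Sum>B\<in>P. x B * q B + q B * x B - q B * q B)"
    by (rule off_diagonal_sum) (rule D)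
  also have "(\<Sum>B\<in>P. \<Sum>C\<in>P. x B * q C + q B * x C - q B * q C) = 2 * (?a * int m) - int m * int m"
    by (simp add: sum.distrib sum_subtractf flip: sum_distrib_left sum_distrib_right sx sq)
  also have "(\<Sum>B\<in>P. x B * q B + q B * x B - q B * q B) = (\<Sum>B\<in>P. 2 * x B - q B)"
    by (rule sum.cong) (auto simp: q_def x_def)
  also have "\<dots> = 2 * ?a - int m"
    by (simp add: sum_subtractf sx sq flip: sum_distrib_left)
  finally have "2 * int (cr_linear P) \<le> (int m - 1) * (2 * ?a - int m)"
    by (simp add: algebra_simps)
  then show ?thesis using that \<open>m \<le> k\<close> \<open>int m \<le> ?a\<close> by blast
qed

text \<open>For integers with sum \<open>r\<close>, equality holds when \<open>r\<close> of them are \<open>1\<close> and the others are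
  \<open>0\<close>. Applied to the deviations of the block sizes from \<open>n div k\<close>, this says that balanced
  sizes maximise the sum of all \<open>min s t\<close>. Split the numbers into positive parts \<open>p\<close> and negative
  parts \<open>v\<close>. A minimum of two positive numbers is at most their average, as is a minimum of two
  non-positive ones, and a minimum of mixed signs is the non-positive number. In terms of the number
  \<open>m\<close> of positive entries and the sum \<open>B\<close> of the negative parts, this bounds the sum by
  \<open>m * r - card I * B\<close>.\<close>
lemma sum_min_le_square:
  fixes x :: "'a \<Rightarrow> int"
  assumes fin: "finite I" and sum: "(\<Sum>i\<in>I. x i) = r" and r: "0 \<le> r" "r \<le> int (card I)"
  shows "(\<Sum>i\<in>I. \<Sum>j\<in>I. min (x i) (x j)) \<le> r * r"
proof -
  define u where "u i = (of_bool (0 < x i) :: int)" for i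
  define p where "p i = max 0 (x i)" for i
  define v where "v i = max 0 (- x i)" for i
  define m A B where "m = (\<Sum>i\<in>I. u i)" and "A = (\<Sum>i\<in>I. p i)" and "B = (\<Sum>i\<in>I. v i)"
  let ?k = "int (card I)"
  have AB: "A = r + B"
    unfolding A_def B_def sum[symmetric] sum.distrib[symmetric]
    by (rule sum.cong) (auto simp: p_def v_def)
  have "m \<le> A" unfolding m_def A_def by (rule sum_mono) (auto simp: u_def p_def)
  have "0 \<le> B" unfolding B_def by (rule sum_nonneg) (auto simp: v_def)
  have "0 \<le> m" unfolding m_def by (rule sum_nonneg) (auto simp: u_def)
  have "2 * (\<Sum>i\<in>I. \<Sum>j\<in>I. min (x i) (x j)) = (\<Sum>i\<in>I. \<Sum>j\<in>I. 2 * min (x i) (x j))"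
    by (simp add: sum_distrib_left)
  also have "\<dots> \<le> (\<Sum>i\<in>I. \<Sum>j\<in>I. u i * p j + p i * u j - v i - v j - (u i * v j + v i * u j))"
    by (intro sum_mono) (auto simp: u_def p_def v_def)
  also have "\<dots> = 2 * (m * A) - 2 * (?k * B) - 2 * (m * B)"
    by (simp add: sum.distrib sum_subtractf m_def A_def B_def
         flip: sum_distrib_left sum_distrib_right)
  finally have "(\<Sum>i\<in>I. \<Sum>j\<in>I. min (x i) (x j)) \<le> m * r - ?k * B"
    by (simp add: AB algebra_simps)
  also have "\<dots> \<le> r * r"
  proof (cases "m \<le> r")
    case True
    then have "m * r \<le> r * r" using r by (intro mult_right_mono) auto
    moreover have "0 \<le> ?k * B" using \<open>0 \<le> B\<close> by simp
    ultimately show ?thesis by linarith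
  next
    case False
    have "?k * (m - r) \<le> ?k * B" using \<open>m \<le> A\<close> AB by (intro mult_left_mono) auto
    moreover have "0 \<le> (?k - r) * (m - r)" using False r by simp
    ultimately show ?thesis by (simp add: algebra_simps)
  qed
  finally show ?thesis .
qed

lemma card_meeting_chords_le_size:
  assumes "finite B" "finite C" "B \<noteq> {}" "C \<noteq> {}" "B \<inter> C = {}"
  shows "card (meeting (chords {B}) (chords {C})) \<le> 2 * min (card B) (card C)"
  using card_meeting_chords_le[of B C] card_meeting_chords_le[of C B]
    card_chords_le[of B] card_chords_le[of C] card_meeting_sym[of "chords {B}" "chords {C}"] assms
  by (auto simp: Int_commute split: if_splits)

text \<open>Subtracting \<open>q\<close> from every size turns the sum of the minima into one over numbers with
  sum \<open>r\<close>. The diagonal terms, which are no pairs of blocks, contribute the size of each block and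
  hence \<open>n\<close> in total.\<close>
lemma cr_circular_le_balanced:
  assumes P: "P \<in> set_partitions n k" and n: "n = k * q + r" "r \<le> k"
  shows "int (cr_circular P) \<le> int k * (int k - 1) * int q + int r * (int r - 1)"
proof -
  note D = set_partitionsD[OF P]
  let ?s = "\<lambda>B. int (card B)"
  have "2 * int (cr_circular P) \<le> (\<Sum>B\<in>P. \<Sum>C\<in>P - {B}. 2 * min (?s B) (?s C))"
    unfolding cr_circular_def chords_Union[of P]
  proof (rule twice_crossings_le)
    fix B C assume BC: "B \<in> P" "C \<in> P" "B \<noteq> C"
    have "card (meeting (chords {B}) (chords {C})) \<le> 2 * min (card B) (card C)"
      by (rule card_meeting_chords_le_size) (use D BC in blast)+
    then show "int (card (meeting (chords {B}) (chords {C}))) \<le> 2 * min (?s B) (?s C)" by linarith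
  qed (use D in \<open>auto simp: finite_chords chords_no_self_crossing\<close>)
  also have "\<dots> = (\<Sum>B\<in>P. \<Sum>C\<in>P. 2 * min (?s B) (?s C)) - (\<Sum>B\<in>P. 2 * min (?s B) (?s B))"
    by (rule off_diagonal_sum) (rule D)
  also have "(\<Sum>B\<in>P. \<Sum>C\<in>P. 2 * min (?s B) (?s C))
      = 2 * (\<Sum>B\<in>P. \<Sum>C\<in>P. int q + min (?s B - int q) (?s C - int q))"
    unfolding sum_distrib_left by (intro sum.cong) (auto simp: min_def)
  also have "\<dots> = 2 * (int k * int k * int q + (\<Sum>B\<in>P. \<Sum>C\<in>P. min (?s B - int q) (?s C - int q)))"
    by (simp add: sum.distrib D)
  also have "(\<Sum>B\<in>P. 2 * min (?s B) (?s B)) = 2 * int n"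
    by (simp add: D flip: sum_distrib_left)
  also have "(\<Sum>B\<in>P. \<Sum>C\<in>P. min (?s B - int q) (?s C - int q)) \<le> int r * int r"
    by (rule sum_min_le_square) (use n in \<open>simp_all add: D sum_subtractf\<close>)
  finally show ?thesis by (simp add: n algebra_simps)
qed

text \<open>The right-hand side is the largest number of crossings of \<open>h\<close> triangles and
  \<open>d\<close> segments with \<open>h'\<close> triangles and \<open>d'\<close> segments. It is attained by
  blocks that are themselves triangles, segments or points. For larger blocks the bound by
  the number of sides suffices: if \<open>1 \<le> h \<le> h'\<close>, the smaller block has at most \<open>2 h + d + 1\<close>
  sides, and twice this number is at most \<open>6 h h' + 2 d h'\<close>.\<close>
lemma card_meeting_chords_le_pieces:
  fixes e e' h h' d d' :: nat
  assumes fin: "finite B" "finite C" and ne: "B \<noteq> {}" "C \<noteq> {}" and disj: "B \<inter> C = {}"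
    and B: "card B - 1 = 2 * h + d" "d \<le> 1" and C: "card C - 1 = 2 * h' + d'" "d' \<le> 1"
  shows "card (meeting (chords {B}) (chords {C})) \<le> 6 * h * h' + 2 * h * d' + 2 * d * h' + d * d'"
proof -
  let ?M = "card (meeting (chords {B}) (chords {C}))"
  have pos: "0 < card B" "0 < card C" using fin ne by (simp_all add: card_gt_0_iff)
  have M1: "?M \<le> 2 * card (chords {B})" using card_meeting_chords_le assms by blast
  have M2: "?M \<le> 2 * card (chords {C})"
    using card_meeting_chords_le[of C B] assms
    by (simp add: Int_commute card_meeting_sym[of "chords {B}" "chords {C}"])
  note c = card_chords_le[OF fin(1) ne(1)] card_chords_le[OF fin(2) ne(2)]
  consider "h = 0" "h' = 0" | "h = 0" "1 \<le> h'" | "1 \<le> h" "h' = 0" | "1 \<le> h" "1 \<le> h'" by linarith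
  then show ?thesis
  proof cases
    case 1
    then have le: "card B \<le> 2" "card C \<le> 2" using B C by auto
    show ?thesis
    proof (cases "card B = 2 \<and> card C = 2")
      case True
      then have "d = 1" "d' = 1" "?M \<le> 1"
        using card_meeting_arcs_le[OF fin disj] B C 1 by (auto simp: chords_small)
      then show ?thesis by simp
    next
      case False
      then have "card (chords {B}) = 0 \<or> card (chords {C}) = 0" using le pos c by auto
      then show ?thesis using M1 M2 by auto
    qed
  next
    case 2
    then have "card (chords {B}) \<le> d" using c B pos by (auto split: if_splits)
    moreover have "2 * d \<le> 2 * d * h'" using 2 by simp
    ultimately have "?M \<le> 2 * d * h'" using M1 by linarith
    then show ?thesis using 2 by simp
  next
    case 3
    then have "card (chords {C}) \<le> d'" using c C pos by (auto split: if_splits)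
    moreover have "2 * d' \<le> 2 * h * d'" using 3 by simp
    ultimately have "?M \<le> 2 * h * d'" using M2 by linarith
    then show ?thesis using 3 by simp
  next
    case 4
    then have B': "?M \<le> 4 * h + 2 * d + 2"
      using 4 M1 c B pos by (auto split: if_splits)
    have "1 \<le> h * h'" "h \<le> h * h'" "d \<le> d * h'" using 4 by auto
    then have "?M \<le> 6 * (h * h') + 2 * (h * d') + 2 * (d * h') + d * d'"
      using B' by linarith
    then show ?thesis by (simp add: mult.assoc)
  qed
qed

text \<open>Pieces of the same block do not cross, so the diagonal terms are subtracted. Because
  \<open>h \<le> h\<^sup>2\<close> and \<open>d = d\<^sup>2\<close>, they are at least as large as the diagonal terms of \<open>H\<close>
  separate triangles and \<open>d\<close> separate segments.\<close>
lemma cr_circular_le_pieces: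
  assumes P: "P \<in> set_partitions n k"
  obtains H d where "2 * int H + int d = int n - int k" "d \<le> k"
    "2 * int (cr_circular P) \<le> 6 * int H * (int H - 1) + 4 * int H * int d + int d * (int d - 1)"
proof -
  note D = set_partitionsD[OF P]
  define h where "h B = int ((card B - 1) div 2)" for B :: "nat set"
  define d where "d B = int ((card B - 1) mod 2)" for B :: "nat set"
  define H d' where "H = (\<Sum>B\<in>P. (card B - 1) div 2)" and "d' = (\<Sum>B\<in>P. (card B - 1) mod 2)"
  have sh: "(\<Sum>B\<in>P. h B) = int H" and sd: "(\<Sum>B\<in>P. d B) = int d'"
    by (simp_all add: h_def d_def H_def d'_def)
  have halves: "2 * int (c div 2) + int (c mod 2) = int c" for c
    using mult_div_mod_eq[of 2 c] by linarith
  have "2 * int H + int d' = (\<Sum>B\<in>P. 2 * h B + d B)"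
    by (simp add: sum.distrib sh sd flip: sum_distrib_left)
  also have "\<dots> = (\<Sum>B\<in>P. int (card B - 1))"
    by (rule sum.cong[OF refl]) (unfold h_def d_def halves, rule refl)
  finally have eq: "2 * int H + int d' = int n - int k" using sum_excess[OF P] by simp
  have "d' \<le> (\<Sum>B\<in>P. 1)" unfolding d'_def by (rule sum_mono) simp
  then have "d' \<le> k" using D by simp
  let ?w = "\<lambda>B C. 6 * (h B * h C) + 2 * (h B * d C) + 2 * (d B * h C) + d B * d C"
  have "2 * int (cr_circular P) \<le> (\<Sum>B\<in>P. \<Sum>C\<in>P - {B}. ?w B C)"
    unfolding cr_circular_def chords_Union[of P]
  proof (rule twice_crossings_le)
    fix B C assume BC: "B \<in> P" "C \<in> P" "B \<noteq> C"
    have "card (meeting (chords {B}) (chords {C}))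
      \<le> 6 * ((card B - 1) div 2) * ((card C - 1) div 2) + 2 * ((card B - 1) div 2) * ((card C - 1) mod 2)
       + 2 * ((card B - 1) mod 2) * ((card C - 1) div 2) + ((card B - 1) mod 2) * ((card C - 1) mod 2)"
      by (rule card_meeting_chords_le_pieces) (use D BC in \<open>simp_all\<close>)
    then have "int (card (meeting (chords {B}) (chords {C})))
      \<le> int (6 * ((card B - 1) div 2) * ((card C - 1) div 2) + 2 * ((card B - 1) div 2) * ((card C - 1) mod 2)
       + 2 * ((card B - 1) mod 2) * ((card C - 1) div 2) + ((card B - 1) mod 2) * ((card C - 1) mod 2))"
      by (simp only: of_nat_le_iff)
    then show "int (card (meeting (chords {B}) (chords {C}))) \<le> ?w B C"
      by (simp add: h_def d_def mult.assoc)
  qed (use D in \<open>auto simp: finite_chords chords_no_self_crossing\<close>)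
  also have "\<dots> = (\<Sum>B\<in>P. \<Sum>C\<in>P. ?w B C) - (\<Sum>B\<in>P. ?w B B)"
    by (rule off_diagonal_sum) (rule D)
  also have "(\<Sum>B\<in>P. \<Sum>C\<in>P. ?w B C) = 6 * (int H * int H) + 4 * (int H * int d') + int d' * int d'"
    by (simp add: sum.distrib flip: sum_distrib_left sum_distrib_right)
       (simp add: sh sd algebra_simps)
  finally have main: "2 * int (cr_circular P) \<le> 6 * (int H * int H) + 4 * (int H * int d') + int d' * int d' - (\<Sum>B\<in>P. ?w B B)" .
  have "6 * int H + int d' = (\<Sum>B\<in>P. 6 * h B + d B)"
    by (simp add: sum.distrib sh sd flip: sum_distrib_left)
  also have "\<dots> \<le> (\<Sum>B\<in>P. ?w B B)"
  proof (rule sum_mono)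
    fix B
    have "h B * 1 \<le> h B * h B \<or> h B = 0" by (cases "h B = 0") (auto simp: h_def)
    then have "h B \<le> h B * h B" by auto
    moreover have "d B * d B = d B" by (cases "(card B - 1) mod 2 = 0") (auto simp: d_def)
    moreover have "0 \<le> h B * d B" by (simp add: h_def d_def)
    ultimately have "6 * h B + d B \<le> 6 * (h B * h B) + 4 * (h B * d B) + d B * d B" by linarith
    then show "6 * h B + d B \<le> ?w B B" by (simp add: mult.commute)
  qed
  finally have "2 * int (cr_circular P)
      \<le> 6 * int H * (int H - 1) + 4 * int H * int d' + int d' * (int d' - 1)"
    using main by (simp add: algebra_simps)
  then show ?thesis using that eq \<open>d' \<le> k\<close> by blast
qed

section \<open>Residue classes as extremal partitions\<close>

text \<open>Points beyond \<open>N\<close> receive distinct labels \<open>m + x\<close>, which are larger than all residues, and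
  so become singletons.\<close>
definition residue_label :: "nat \<Rightarrow> nat \<Rightarrow> nat \<Rightarrow> nat" where
  "residue_label m N x = (if x \<le> N then x mod m else m + x)"

definition residue_partition :: "nat \<Rightarrow> nat \<Rightarrow> nat \<Rightarrow> nat set set" where
  "residue_partition m N n =
     (\<lambda>v. {y \<in> {1..n}. residue_label m N y = v}) ` residue_label m N ` {1..n}"

lemma residue_label_image:
  assumes "0 < m" "m \<le> N" "N \<le> n"
  shows "residue_label m N ` {1..n} = {..<m} \<union> {m + N<..m + n}" (is "?L = ?R")
proof
  show "?L \<subseteq> ?R" using assms by (auto simp: residue_label_def)
  show "?R \<subseteq> ?L"
  proof
    fix v assume v: "v \<in> ?R"
    show "v \<in> ?L"
    proof (cases "v < m")
      case True
      define x where "x = (if v = 0 then m else v)"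
      have "x \<in> {1..n}" "residue_label m N x = v"
        using True assms by (auto simp: x_def residue_label_def)
      then show ?thesis by (metis imageI)
    next
      case False
      then have "v - m \<in> {1..n}" "residue_label m N (v - m) = v"
        using v by (auto simp: residue_label_def)
      then show ?thesis by (metis imageI)
    qed
  qed
qed

lemma residue_partition_in_set_partitions:
  assumes "0 < m" "m \<le> N" "N \<le> n"
  shows "residue_partition m N n \<in> set_partitions n (m + (n - N))"
proof -
  let ?f = "residue_label m N"
  have "partition_on {1..n} (residue_partition m N n)"
    by (auto simp: partition_on_def disjoint_def residue_partition_def)
  moreover have "card (residue_partition m N n) = card (?f ` {1..n})"
    unfolding residue_partition_def
  proof (rule card_image, rule inj_onI)
    fix v w assume "v \<in> ?f ` {1..n}"
      and eq: "{y \<in> {1..n}. ?f y = v} = {y \<in> {1..n}. ?f y = w}"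
    then obtain y where "y \<in> {1..n}" "?f y = v" by blast
    then have "y \<in> {y \<in> {1..n}. ?f y = w}" unfolding eq[symmetric] by simp
    then show "v = w" using \<open>?f y = v\<close> by simp
  qed
  moreover have "card (?f ` {1..n}) = m + (n - N)"
    unfolding residue_label_image[OF assms]
    by (subst card_Un_disjoint) (use assms in auto)
  ultimately show ?thesis by (simp add: set_partitions_def)
qed

lemma mod_eq_gap:
  fixes x y m :: nat
  assumes "y mod m = x mod m" "x < y"
  shows "x + m \<le> y"
proof -
  have "m dvd y - x" using assms by (simp add: mod_eq_dvd_iff_nat)
  then have "m \<le> y - x" using assms by (intro dvd_imp_le) auto
  then show ?thesis using assms by simp
qed

lemma residue_partition_class:
  assumes "1 \<le> x" "x \<le> N" "N \<le> n" "0 < m"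
  shows "{y \<in> {1..N}. y mod m = x mod m} \<in> residue_partition m N n"
proof -
  have "x mod m < m + y" for y using assms by (simp add: trans_less_add1)
  then have "m + y \<noteq> x mod m" for y by (metis less_irrefl)
  then have "residue_label m N y = x mod m \<longleftrightarrow> y \<le> N \<and> y mod m = x mod m" for y
    by (auto simp: residue_label_def)
  then have "{y \<in> {1..N}. y mod m = x mod m} = {y \<in> {1..n}. residue_label m N y = x mod m}"
    using assms by auto
  moreover have "x mod m \<in> residue_label m N ` {1..n}"
    using assms by (intro image_eqI[of _ _ x]) (auto simp: residue_label_def)
  ultimately show ?thesis unfolding residue_partition_def by blast
qed

lemma residue_partition_arc:
  assumes "1 \<le> x" "x + m \<le> N" "N \<le> n" "0 < m"
  shows "(x, x + m) \<in> arcs (residue_partition m N n)"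
proof -
  define B where "B = {y \<in> {1..N}. y mod m = x mod m}"
  have "B \<in> residue_partition m N n"
    unfolding B_def by (rule residue_partition_class) (use assms in auto)
  moreover have "\<not> (x < y \<and> y < x + m)" if "y \<in> B" for y
    using mod_eq_gap[of y m x] that by (auto simp: B_def)
  moreover have "x \<in> B" "x + m \<in> B" "x < x + m" using assms by (auto simp: B_def)
  ultimately show ?thesis unfolding arcs_def by blast
qed

text \<open>The hypotheses on \<open>q\<close> say that \<open>i + q * m\<close> is the last element of the class of \<open>i\<close> and that
  this class has at least three elements.\<close>
lemma residue_partition_closing_chord:
  assumes i: "1 \<le> i" "i \<le> m" and q: "2 \<le> q"
    and last: "i + q * m \<le> N" "N < i + q * m + m" and "N \<le> n"
  shows "(i, i + q * m) \<in> chords (residue_partition m N n)"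
proof -
  let ?B = "{y \<in> {1..N}. y mod m = i mod m}"
  have B: "?B \<in> residue_partition m N n"
    by (rule residue_partition_class) (use assms in auto)
  have m: "0 < m" using i by simp
  have qm: "2 * m \<le> q * m" using q by (rule mult_right_mono) simp
  have "Min ?B = i"
  proof (rule Min_eqI)
    fix y assume "y \<in> ?B"
    then show "i \<le> y" using mod_eq_gap[of i m y] i by (cases "y < i") auto
  qed (use assms in auto)
  moreover have "Max ?B = i + q * m"
  proof (rule Max_eqI)
    fix y assume "y \<in> ?B"
    then show "y \<le> i + q * m"
      using mod_eq_gap[of y m "i + q * m"] last by (cases "i + q * m < y") auto
  qed (use assms in auto)
  moreover have "i + m \<le> i + q * m" using qm by linarith
  then have "i + m \<le> N" using last(1) by linarith
  then have "{i, i + m, i + q * m} \<subseteq> ?B" using i last by simp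
  then have "card {i, i + m, i + q * m} \<le> card ?B" by (rule card_mono[rotated]) simp
  moreover have "i \<noteq> i + m" "i \<noteq> i + q * m" "i + m \<noteq> i + q * m" using m qm by linarith+
  then have "card {i, i + m, i + q * m} = 3" by simp
  ultimately have "(i, i + q * m) = (Min ?B, Max ?B)" "3 \<le> card ?B" by simp_all
  then show ?thesis using B unfolding chords_def by blast
qed

text \<open>Crossings in a set that contains all short chords \<open>(x, x + m)\<close> inside \<open>{1..N}\<close> and long
  chords \<open>(i, l i)\<close> from the first \<open>m\<close> points to the last \<open>m\<close> points. Two short chords cross if
  their left ends differ by some \<open>d < m\<close>, which gives the first sum; the bound \<open>t\<close> on \<open>d\<close> allows
  \<open>N - m\<close> to be less than \<open>m\<close>. The long chord from \<open>i\<close> crosses the short chords over its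
  left end, of which there are \<open>i - 1\<close>, and those over its right end, of which there are \<open>N - l i\<close>.
  Finally it crosses the long chords from \<open>{g i..<i}\<close>. Here \<open>g\<close> marks off a range on which \<open>l\<close> is
  increasing, since \<open>l\<close> can drop where the class sizes change.\<close>
lemma crossings_ge:
  fixes A :: "(nat \<times> nat) set" and l g :: "nat \<Rightarrow> nat"
  assumes fin: "finite A"
    and short: "\<And>x. 1 \<le> x \<Longrightarrow> x + m \<le> N \<Longrightarrow> (x, x + m) \<in> A"
    and t: "t \<le> m" "t + m \<le> N"
    and long: "\<And>i. 1 \<le> i \<Longrightarrow> i \<le> c \<Longrightarrow> (i, l i) \<in> A"
    and l: "\<And>i. 1 \<le> i \<Longrightarrow> i \<le> c \<Longrightarrow> i + 2 * m \<le> l i \<and> N < l i + m \<and> l i \<le> N"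
    and c: "c \<le> m"
    and g: "\<And>i. 1 \<le> i \<Longrightarrow> i \<le> c \<Longrightarrow> 1 \<le> g i \<and> g i \<le> i"
      "\<And>i j. g j \<le> i \<Longrightarrow> i < j \<Longrightarrow> j \<le> c \<Longrightarrow> l i < l j"
  shows "(\<Sum>d=1..<t. int N - int m - int d)
      + (\<Sum>i=1..c. (int i - 1) + (int N - int (l i)) + (int i - int (g i))) \<le> int (crossings A)"
proof -
  let ?C = "{((i, j), (i', j')). (i, j) \<in> A \<and> (i', j') \<in> A \<and> i < i' \<and> i' < j \<and> j < j'}"
  define I1 where "I1 = (SIGMA d:{1..<t}. {1..N - m - d})"
  define I2 where "I2 = (SIGMA i:{1..c}. {1..<i})"
  define I3 where "I3 = (SIGMA i:{1..c}. {l i - m<..N - m})"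
  define I4 where "I4 = (SIGMA j:{1..c}. {g j..<j})"
  define S1 where "S1 = (\<lambda>(d, x). ((x, x + m), (x + d, x + d + m))) ` I1"
  define S2 where "S2 = (\<lambda>(i, x). ((x, x + m), (i, l i))) ` I2"
  define S3 where "S3 = (\<lambda>(i, x). ((i, l i), (x, x + m))) ` I3"
  define S4 where "S4 = (\<lambda>(j, i). ((i, l i), (j, l j))) ` I4"
  have finC: "finite ?C" by (rule finite_subset[of _ "A \<times> A"]) (use fin in auto)
  have sub1: "S1 \<subseteq> ?C"
    unfolding S1_def I1_def using t by (auto intro!: short)
  have sub2: "S2 \<subseteq> ?C"
  proof -
    have "(x, x + m) \<in> A \<and> (i, l i) \<in> A \<and> x < i \<and> i < x + m \<and> x + m < l i"
      if "1 \<le> x" "x < i" "i \<le> c" for i x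
      using that l[of i] long[of i] c short[of x] by auto
    then show ?thesis unfolding S2_def I2_def by auto
  qed
  have sub3: "S3 \<subseteq> ?C"
  proof -
    have "(x, x + m) \<in> A \<and> (i, l i) \<in> A \<and> i < x \<and> x < l i \<and> l i < x + m"
      if "1 \<le> i" "i \<le> c" "l i - m < x" "x \<le> N - m" for i x
      using that l[of i] long[of i] c short[of x] by auto
    then show ?thesis unfolding S3_def I3_def by auto
  qed
  have sub4: "S4 \<subseteq> ?C"
  proof -
    have "(i, l i) \<in> A \<and> (j, l j) \<in> A \<and> i < j \<and> j < l i \<and> l i < l j"
      if "1 \<le> j" "j \<le> c" "g j \<le> i" "i < j" for i j
      using that l[of i] l[of j] long[of i] long[of j] c g(1)[of j] g(2)[of j i] by auto
    then show ?thesis unfolding S4_def I4_def by auto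
  qed
  have len: "l i \<noteq> i + m" if "1 \<le> i" "i \<le> c" for i
    using l[OF that] that c by auto
  have fins: "finite S1" "finite S2" "finite S3" "finite S4"
    by (auto simp: S1_def S2_def S3_def S4_def I1_def I2_def I3_def I4_def)
  \<comment> \<open>The four kinds of crossings are told apart by which of the two chords is short.\<close>
  define u v :: "(nat \<times> nat) \<times> (nat \<times> nat) \<Rightarrow> bool"
    where "u = (\<lambda>((i, j), _). j = i + m)" and "v = (\<lambda>(_, (i, j)). j = i + m)"
  have shape1: "u p \<and> v p" if "p \<in> S1" for p
    using that by (auto simp: S1_def u_def v_def)
  have shape2: "u p \<and> \<not> v p" if "p \<in> S2" for p
  proof -
    from that obtain i x where "p = ((x, x + m), (i, l i))" "1 \<le> i" "i \<le> c"
      by (auto simp: S2_def I2_def)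
    then show ?thesis using len[of i] by (simp add: u_def v_def)
  qed
  have shape3: "\<not> u p \<and> v p" if "p \<in> S3" for p
  proof -
    from that obtain i x where "p = ((i, l i), (x, x + m))" "1 \<le> i" "i \<le> c"
      by (auto simp: S3_def I3_def)
    then show ?thesis using len[of i] by (simp add: u_def v_def)
  qed
  have shape4: "\<not> u p \<and> \<not> v p" if "p \<in> S4" for p
  proof -
    from that obtain i j where "p = ((i, l i), (j, l j))" "1 \<le> j" "j \<le> c" "g j \<le> i" "i < j"
      by (auto simp: S4_def I4_def)
    then show ?thesis using len[of i] len[of j] g(1)[of j] by (simp add: u_def v_def)
  qed
  have "S1 \<inter> S2 = {}" "(S1 \<union> S2) \<inter> S3 = {}" "(S1 \<union> S2 \<union> S3) \<inter> S4 = {}"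
    using shape1 shape2 shape3 shape4 by blast+
  then have "card S1 + card S2 + card S3 + card S4 = card (S1 \<union> S2 \<union> S3 \<union> S4)"
    using fins by (simp add: card_Un_disjoint)
  also have "\<dots> \<le> card ?C"
    by (rule card_mono[OF finC]) (use sub1 sub2 sub3 sub4 in blast)
  finally have le: "card S1 + card S2 + card S3 + card S4 \<le> crossings A"
    by (simp add: crossings_def)
  have "card S1 = card I1" unfolding S1_def by (rule card_image, rule inj_onI) clarsimp
  also have "int \<dots> = (\<Sum>d=1..<t. int (N - m - d))" by (simp add: I1_def card_SigmaI)
  also have "\<dots> = (\<Sum>d=1..<t. int N - int m - int d)"
  proof (rule sum.cong[OF refl])
    fix d assume "d \<in> {1..<t}"
    then show "int (N - m - d) = int N - int m - int d" using t by simp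
  qed
  finally have c1: "int (card S1) = (\<Sum>d=1..<t. int N - int m - int d)" .
  have "card S2 = card I2" unfolding S2_def by (rule card_image, rule inj_onI) clarsimp
  also have "int \<dots> = (\<Sum>i=1..c. int (i - 1))" by (simp add: I2_def card_SigmaI)
  also have "\<dots> = (\<Sum>i=1..c. int i - 1)"
  proof (rule sum.cong[OF refl])
    fix i assume "i \<in> {1..c}"
    then show "int (i - 1) = int i - 1" by simp
  qed
  finally have c2: "int (card S2) = (\<Sum>i=1..c. int i - 1)" .
  have "card S3 = card I3" unfolding S3_def by (rule card_image, rule inj_onI) clarsimp
  also have "int \<dots> = (\<Sum>i=1..c. int (N - m - (l i - m)))" by (simp add: I3_def card_SigmaI)
  also have "\<dots> = (\<Sum>i=1..c. int N - int (l i))"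
  proof (rule sum.cong[OF refl])
    fix i assume "i \<in> {1..c}"
    then show "int (N - m - (l i - m)) = int N - int (l i)" using l[of i] by simp
  qed
  finally have c3: "int (card S3) = (\<Sum>i=1..c. int N - int (l i))" .
  have "card S4 = card I4" unfolding S4_def by (rule card_image, rule inj_onI) clarsimp
  also have "int \<dots> = (\<Sum>j=1..c. int (j - g j))" by (simp add: I4_def card_SigmaI)
  also have "\<dots> = (\<Sum>j=1..c. int j - int (g j))"
  proof (rule sum.cong[OF refl])
    fix j assume "j \<in> {1..c}"
    then show "int (j - g j) = int j - int (g j)" using g(1)[of j] by simp
  qed
  finally have c4: "int (card S4) = (\<Sum>j=1..c. int j - int (g j))" .
  show ?thesis using le c1 c2 c3 c4 unfolding sum.distrib by linarith
qed

section \<open>Evaluation of the maxima\<close>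

lemma twice_sum_diff:
  fixes x :: int
  assumes "1 \<le> t"
  shows "2 * (\<Sum>d=1..<t. x - int d) = (int t - 1) * (2 * x - int t)"
  using assms
proof (induction t rule: dec_induct)
  case (step t)
  have "2 * (\<Sum>d=1..<Suc t. x - int d) = 2 * (\<Sum>d=1..<t. x - int d) + 2 * (x - int t)"
    using step(1) by simp
  then show ?case unfolding step(3) by (simp add: algebra_simps)
qed simp

lemma twice_sum_upto: "2 * (\<Sum>i=1..c. int i) = int c * (int c + 1)"
proof (induction c)
  case (Suc c)
  have "2 * (\<Sum>i=1..Suc c. int i) = 2 * (\<Sum>i=1..c. int i) + 2 * int (Suc c)" by simp
  also have "\<dots> = int c * (int c + 1) + 2 * int (Suc c)" by (simp only: Suc)
  finally show ?case by (simp add: algebra_simps)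
qed simp

lemma finite_arcs_partition: "P \<in> set_partitions n k \<Longrightarrow> finite (arcs P)"
  using set_partitionsD[of P n k] by (auto simp: arcs_Union[of P] finite_arcs)

lemma finite_chords_partition: "P \<in> set_partitions n k \<Longrightarrow> finite (chords P)"
  using set_partitionsD[of P n k] by (auto simp: chords_Union[of P] finite_chords)

lemma crossings_mono:
  assumes "A \<subseteq> A'" "finite A'"
  shows "crossings A \<le> crossings A'"
  unfolding crossings_def
  by (rule card_mono, rule finite_subset[of _ "A' \<times> A'"]) (use assms in auto)

lemma max_cr_linear_eqI:
  assumes "\<And>P. P \<in> set_partitions n k \<Longrightarrow> cr_linear P \<le> v"
    and "Q \<in> set_partitions n k" "v \<le> cr_linear Q"
  shows "max_cr_linear n k = v"
  unfolding max_cr_linear_def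
proof (rule Max_eqI)
  show "v \<in> cr_linear ` set_partitions n k"
    using assms by (intro image_eqI[of _ _ Q]) (auto intro: antisym)
qed (use assms finite_set_partitions in auto)

lemma max_cr_circular_eqI:
  assumes "\<And>P. P \<in> set_partitions n k \<Longrightarrow> cr_circular P \<le> v"
    and "Q \<in> set_partitions n k" "v \<le> cr_circular Q"
  shows "max_cr_circular n k = v"
  unfolding max_cr_circular_def
proof (rule Max_eqI)
  show "v \<in> cr_circular ` set_partitions n k"
    using assms by (intro image_eqI[of _ _ Q]) (auto intro: antisym)
qed (use assms finite_set_partitions in auto)

text \<open>Only crossings of arcs with arcs count here, so no long chords are used (\<open>c = 0\<close>).\<close>
lemma cr_linear_residue_partition_ge:
  assumes k: "1 \<le> k" "k \<le> n" and t: "1 \<le> t" "t \<le> k" "t + k \<le> n"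
  shows "(int t - 1) * (2 * (int n - int k) - int t) \<le> 2 * int (cr_linear (residue_partition k n n))"
proof -
  have P: "residue_partition k n n \<in> set_partitions n k"
    using residue_partition_in_set_partitions[of k n n] k by simp
  have "(\<Sum>d=1..<t. int n - int k - int d)
      + (\<Sum>i=1..0. (int i - 1) + (int n - int i) + (int i - int i))
    \<le> int (crossings (arcs (residue_partition k n n)))"
    by (rule crossings_ge[where l = id and g = id, simplified id_def])
       (use k t finite_arcs_partition[OF P] in \<open>auto intro!: residue_partition_arc\<close>)
  then show ?thesis
    using twice_sum_diff[OF t(1), of "int n - int k"] by (simp add: cr_linear_def)
qed

text \<open>The quadratic \<open>(m - 1) (2 a - m)\<close>, where \<open>a = n - k\<close>, does not decrease on the integers
  \<open>m \<le> a\<close>, and every block that is not a singleton uses up excess, so the extreme value is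
  \<open>m = min k a\<close>.\<close>
lemma cr_linear_le_general:
  assumes P: "P \<in> set_partitions n k" and t: "t = min k (n - k)" and k: "k \<le> n"
  shows "2 * int (cr_linear P) \<le> (int t - 1) * (2 * (int n - int k) - int t)"
proof -
  obtain m where m: "m \<le> k" "int m \<le> int n - int k"
    and le: "2 * int (cr_linear P) \<le> (int m - 1) * (2 * (int n - int k) - int m)"
    using cr_linear_le[OF P] .
  have "m \<le> t" "int t \<le> int n - int k" using m t k by auto
  then have "0 \<le> (int t - int m) * (2 * (int n - int k) - int t - int m + 1)" by simp
  then show ?thesis using le by (simp add: algebra_simps)
qed

lemma twice_choose_two: "2 * int (m choose 2) = int m * (int m - 1)"
proof (cases m)
  case (Suc j)
  have "even (m * (m - 1))" by auto
  then have "2 * (m choose 2) = m * (m - 1)" by (simp add: choose_two)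
  then have "int (2 * (m choose 2)) = int (m * (m - 1))" by (rule arg_cong)
  then show ?thesis using Suc by (simp add: algebra_simps)
qed simp

text \<open>The two regimes of the linear maximum are \<open>t = k\<close> and \<open>t = n - k\<close>.\<close>
lemma max_cr_linear_eq:
  assumes k: "1 \<le> k" "k \<le> n" and t: "t = min k (n - k)" 
  shows "2 * int (max_cr_linear n k) = (int t - 1) * (2 * (int n - int k) - int t)"
proof -
  let ?Q = "residue_partition k n n"
  have Q: "?Q \<in> set_partitions n k"
    using residue_partition_in_set_partitions[of k n n] k by simp
  have ge: "(int t - 1) * (2 * (int n - int k) - int t) \<le> 2 * int (cr_linear ?Q)"
  proof (cases "t = 0")
    case True
    then have "n = k" using k t by auto
    then show ?thesis using True by simp
  next
    case False
    then show ?thesis using k t by (intro cr_linear_residue_partition_ge) auto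
  qed
  have up: "2 * int (cr_linear P) \<le> (int t - 1) * (2 * (int n - int k) - int t)"
    if "P \<in> set_partitions n k" for P
    by (rule cr_linear_le_general[OF that t k(2)])
  have "max_cr_linear n k = cr_linear ?Q"
  proof (rule max_cr_linear_eqI[OF _ Q order_refl])
    fix P assume "P \<in> set_partitions n k"
    from up[OF this] ge show "cr_linear P \<le> cr_linear ?Q" by linarith
  qed
  then show ?thesis using ge up[OF Q] by simp
qed

text \<open>The classes of \<open>1, \<dots>, r\<close> have one element more than the others. Therefore the last
  element \<open>l i\<close> of the class of \<open>i\<close> increases for \<open>i \<le> r\<close> and again for \<open>i > r\<close>, but
  drops in between, and the closing sides cross exactly within these two ranges.\<close>
lemma cr_circular_residue_partition_ge:
  assumes k: "1 \<le> k" "3 * k \<le> n" and q: "q = n div k" and r: "r = n mod k"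
  shows "(int k - 1) * int n - int r * (int k - int r) \<le> int (cr_circular (residue_partition k n n))"
proof -
  let ?Q = "residue_partition k n n"
  have n: "n = q * k + r" and rk: "r < k" using k by (simp_all add: q r)
  have q3: "3 \<le> q" unfolding q using k by (simp add: less_eq_div_iff_mult_less_eq)
  \<comment> \<open>The smaller classes have \<open>q\<close> elements, hence \<open>q - 1\<close> steps from the first to the last.\<close>
  define q' where "q' = q - 1"
  have n': "n = q' * k + k + r" and q2: "2 \<le> q'" using n q3 by (cases q; simp add: q'_def)+
  have qk: "2 * k \<le> q' * k" using q2 by (rule mult_right_mono) simp
  have P: "?Q \<in> set_partitions n k"
    using residue_partition_in_set_partitions[of k n n] k by simp
  define l where "l i = i + (if i \<le> r then Suc q' else q') * k" for i
  define g where "g i = (if i \<le> r then 1 else Suc r)" for i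
  have "(\<Sum>d=1..<k. int n - int k - int d)
      + (\<Sum>i=1..k. (int i - 1) + (int n - int (l i)) + (int i - int (g i)))
    \<le> int (crossings (chords ?Q))"
  proof (rule crossings_ge)
    show "finite (chords ?Q)" by (rule finite_chords_partition[OF P])
    show "(x, x + k) \<in> chords ?Q" if "1 \<le> x" "x + k \<le> n" for x
      using residue_partition_arc[OF that] k by (simp add: chords_def)
    show "(i, l i) \<in> chords ?Q" if "1 \<le> i" "i \<le> k" for i
      unfolding l_def
      by (rule residue_partition_closing_chord) (use that n' q2 rk in auto)
    show "i + 2 * k \<le> l i \<and> n < l i + k \<and> l i \<le> n" if "1 \<le> i" "i \<le> k" for i
      using that n' qk rk by (auto simp: l_def)
    show "1 \<le> g i \<and> g i \<le> i" if "1 \<le> i" for i using that by (auto simp: g_def)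
    show "l i < l j" if "g j \<le> i" "i < j" for i j
      using that by (auto simp: g_def l_def split: if_splits)
  qed (use k in auto)
  moreover have "(\<Sum>i=1..k. (int i - 1) + (int n - int (l i)) + (int i - int (g i)))
      = (\<Sum>i=1..k. int i - 2 + (if i \<le> r then int r else int k))"
    by (rule sum.cong) (auto simp: l_def g_def n' algebra_simps)
  moreover have "\<dots> = (\<Sum>i=1..k. int i) - 2 * int k + (\<Sum>i=1..k. if i \<le> r then int r else int k)"
    by (simp add: sum.distrib sum_subtractf)
  moreover have "(\<Sum>i=1..k. if i \<le> r then int r else int k) = int r * int r + (int k - int r) * int k"
  proof -
    have "{1..k} \<inter> {i. i \<le> r} = {1..r}" "{1..k} \<inter> - {i. i \<le> r} = {r + 1..k}" using rk by auto
    then show ?thesis using rk by (simp add: sum.If_cases of_nat_diff)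
  qed
  ultimately have "2 * (\<Sum>d=1..<k. int n - int k - int d)
      + (2 * (\<Sum>i=1..k. int i) - 4 * int k + 2 * (int r * int r + (int k - int r) * int k))
      \<le> 2 * int (cr_circular ?Q)"
    by (simp add: cr_circular_def)
  then show ?thesis
    unfolding twice_sum_upto twice_sum_diff[OF k(1), of "int n - int k"] by (simp add: algebra_simps)
qed

lemma max_cr_circular_balanced:
  assumes k: "1 \<le> k" "3 * k \<le> n" and r: "r = n mod k"
  shows "int (max_cr_circular n k) = (int k - 1) * int n - int r * (int k - int r)"
proof -
  let ?Q = "residue_partition k n n"
  have Q: "?Q \<in> set_partitions n k"
    using residue_partition_in_set_partitions[of k n n] k by simp
  have n: "n = k * (n div k) + r" and rk: "r \<le> k" using k by (simp_all add: r)
  note ge = cr_circular_residue_partition_ge[OF k refl r]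
  have eq: "int k * (int k - 1) * int (n div k) + int r * (int r - 1)
      = (int k - 1) * int n - int r * (int k - int r)"
  proof -
    have "int n = int k * int (n div k) + int r" using arg_cong[OF n, of int] by simp
    then show ?thesis by (simp add: algebra_simps)
  qed
  have up: "int (cr_circular P) \<le> (int k - 1) * int n - int r * (int k - int r)"
    if "P \<in> set_partitions n k" for P
    using cr_circular_le_balanced[OF that n rk] unfolding eq .
  have "max_cr_circular n k = cr_circular ?Q"
  proof (rule max_cr_circular_eqI[OF _ Q order_refl])
    fix P assume "P \<in> set_partitions n k"
    from up[OF this] ge show "cr_circular P \<le> cr_circular ?Q" by linarith
  qed
  then show ?thesis using ge up[OF Q] by simp
qed


text \<open>Substituting \<open>d = a - 2 H\<close> with \<open>a = n - k\<close> leaves the single parameter \<open>H\<close>. Its lower bound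
  holds because each block contributes at most one segment: if \<open>a > k\<close>, triangles are unavoidable.\<close>
lemma cr_circular_le_shape:
  assumes P: "P \<in> set_partitions n k" and k: "k \<le> n" and h: "h = (n - k) div 2"
  obtains H where "H \<le> h" "n \<le> 2 * k + 2 * H"
    "2 * int (cr_circular P) \<le> 2 * (int H * (int H - 2)) + (int n - int k) * (int n - int k - 1)"
proof -
  obtain H d where d: "2 * int H + int d = int n - int k" "d \<le> k"
    and le: "2 * int (cr_circular P) \<le> 6 * int H * (int H - 1) + 4 * int H * int d + int d * (int d - 1)"
    using cr_circular_le_pieces[OF P] .
  have "6 * int H * (int H - 1) + 4 * int H * int d + int d * (int d - 1)
      = 2 * (int H * (int H - 2)) + (2 * int H + int d) * (2 * int H + int d - 1)"
    by (simp add: algebra_simps)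
  also have "\<dots> = 2 * (int H * (int H - 2)) + (int n - int k) * (int n - int k - 1)"
    by (simp only: d)
  finally have "2 * int (cr_circular P)
      \<le> 2 * (int H * (int H - 2)) + (int n - int k) * (int n - int k - 1)"
    using le by simp
  moreover have "H \<le> h" using d k unfolding h by linarith
  moreover have "n \<le> 2 * k + 2 * H" using d by linarith
  ultimately show ?thesis using that by blast
qed

text \<open>For \<open>d = 1\<close> the class of \<open>h + 1\<close> has only two of the three points, and it is the last
  class, so the triangles are those of \<open>1, \<dots>, h\<close> and their last points are increasing.\<close>
lemma cr_circular_triangles_ge:
  assumes a: "2 * h + d = n - k" "d \<le> 1" and m: "h + d \<le> k" "1 \<le> h + d" and k: "k \<le> n"
  shows "3 * (int h * (int h - 1)) + 2 * int h * int d
    \<le> int (cr_circular (residue_partition (h + d) (3 * h + 2 * d) n))"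
proof -
  define m N where "m = h + d" and "N = 3 * h + 2 * d"
  let ?Q = "residue_partition m N n"
  have mN: "0 < m" "m \<le> N" "N \<le> n" using a m k by (auto simp: m_def N_def)
  note P = residue_partition_in_set_partitions[OF mN]
  have "(\<Sum>d=1..<m. int N - int m - int d)
      + (\<Sum>i=1..h. (int i - 1) + (int N - int (i + 2 * m)) + (int i - int (1::nat)))
    \<le> int (crossings (chords ?Q))"
  proof (rule crossings_ge)
    show "finite (chords ?Q)" by (rule finite_chords_partition[OF P])
    show "(x, x + m) \<in> chords ?Q" if "1 \<le> x" "x + m \<le> N" for x
      using residue_partition_arc[OF that mN(3,1)] by (simp add: chords_def)
    show "(i, i + 2 * m) \<in> chords ?Q" if "1 \<le> i" "i \<le> h" for i
      by (rule residue_partition_closing_chord)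
        (use that a mN in \<open>auto simp: m_def N_def\<close>)
  qed (use a mN in \<open>auto simp: m_def N_def\<close>)
  moreover have "(\<Sum>i=1..h. (int i - 1) + (int N - int (i + 2 * m)) + (int i - int (1::nat)))
      = (\<Sum>i=1..h. int i + (int h - 2))"
    by (rule sum.cong) (auto simp: m_def N_def)
  moreover have "\<dots> = (\<Sum>i=1..h. int i) + int h * (int h - 2)"
    by (simp add: sum.distrib)
  ultimately have "2 * (\<Sum>d=1..<m. int N - int m - int d)
      + (2 * (\<Sum>i=1..h. int i) + 2 * (int h * (int h - 2))) \<le> 2 * int (cr_circular ?Q)"
    by (simp add: cr_circular_def)
  moreover have "2 * (\<Sum>d=1..<m. int N - int m - int d) = (int m - 1) * (2 * (int N - int m) - int m)"
    by (rule twice_sum_diff) (use mN in simp)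
  ultimately have "(int m - 1) * (2 * (int N - int m) - int m) + int h * (int h + 1)
      + 2 * (int h * (int h - 2)) \<le> 2 * int (cr_circular ?Q)"
    unfolding twice_sum_upto by linarith
  moreover have "d = 0 \<or> d = 1" using a by auto
  ultimately show ?thesis
    unfolding m_def[symmetric] N_def[symmetric]
    by (auto simp: m_def N_def algebra_simps)
qed

text \<open>Since \<open>H (H - 2) = (H - 1)\<^sup>2 - 1\<close>, the bound increases with \<open>H \<ge> 1\<close>, and the largest
  possible \<open>H\<close> is \<open>h\<close>. The value at \<open>H = 0\<close> is no larger if \<open>h \<ge> 2\<close>, and \<open>H = 0\<close> cannot
  occur if \<open>2 k < n\<close>.\<close>
lemma max_cr_circular_triangles:
  assumes k: "k < n" "n \<le> 3 * k" and a: "n - k = 2 * h + d" "d \<le> 1"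
    and h: "2 * k < n \<or> 2 \<le> h"
  shows "max_cr_circular n k = 6 * (h choose 2) + 2 * h * d"
proof -
  let ?Q = "residue_partition (h + d) (3 * h + 2 * d) n"
  let ?v = "3 * (int h * (int h - 1)) + 2 * int h * int d"
  have d: "d = 0 \<or> d = 1" using a by auto
  have le: "h + d \<le> k" and pos: "0 < h + d" using a k d by auto
  have "?Q \<in> set_partitions n (h + d + (n - (3 * h + 2 * d)))"
    by (rule residue_partition_in_set_partitions) (use pos a k le in auto)
  moreover have "h + d + (n - (3 * h + 2 * d)) = k" using a k le by auto
  ultimately have Q: "?Q \<in> set_partitions n k" by simp
  have ge: "?v \<le> int (cr_circular ?Q)"
    by (rule cr_circular_triangles_ge) (use a k le pos in auto)
  have up: "int (cr_circular P) \<le> ?v" if P: "P \<in> set_partitions n k" for P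
  proof -
    obtain H where H: "H \<le> (n - k) div 2" "n \<le> 2 * k + 2 * H"
      "2 * int (cr_circular P) \<le> 2 * (int H * (int H - 2)) + (int n - int k) * (int n - int k - 1)"
      using cr_circular_le_shape[OF P _ refl] k by auto
    have Hh: "H \<le> h" using H(1) a d by auto
    have "int H * (int H - 2) \<le> int h * (int h - 2)"
    proof (cases "H = 0")
      case True
      then have "2 \<le> h" using H(2) h by auto
      then show ?thesis using True by simp
    next
      case False
      then have "0 \<le> (int h - int H) * (int h + int H - 2)" using Hh by simp
      then show ?thesis by (simp add: algebra_simps)
    qed
    moreover have "int n - int k = 2 * int h + int d" using a k by linarith
    ultimately have "2 * int (cr_circular P)
        \<le> 2 * (int h * (int h - 2)) + (2 * int h + int d) * (2 * int h + int d - 1)"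
      using H(3) by simp
    then show ?thesis using d by (auto simp: algebra_simps)
  qed
  have "max_cr_circular n k = cr_circular ?Q"
  proof (rule max_cr_circular_eqI[OF _ Q order_refl])
    fix P assume "P \<in> set_partitions n k"
    from up[OF this] ge show "cr_circular P \<le> cr_circular ?Q" by linarith
  qed
  then have "int (max_cr_circular n k) = ?v" using ge up[OF Q] by simp
  also have "\<dots> = int (6 * (h choose 2) + 2 * h * d)"
    using twice_choose_two[of h] by simp
  finally show ?thesis by (simp only: of_nat_eq_iff)
qed

text \<open>For \<open>n - k \<le> 5\<close> there are at most two triangles, and \<open>H (H - 2) \<le> 0\<close>. The bound is
  attained by \<open>n - k\<close> pairwise crossing segments.\<close>
lemma max_cr_circular_small_excess:
  assumes k: "1 \<le> k" "k \<le> n" "n \<le> 2 * k" and a: "n - k \<le> 5"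
  shows "max_cr_circular n k = (n - k) choose 2"
proof -
  let ?Q = "residue_partition k n n"
  have Q: "?Q \<in> set_partitions n k"
    using residue_partition_in_set_partitions[of k n n] k by simp
  have eq: "(int n - int k) * (int n - int k - 1) = 2 * int ((n - k) choose 2)"
    using twice_choose_two[of "n - k"] k by (simp add: of_nat_diff)
  show ?thesis
  proof (rule max_cr_circular_eqI[OF _ Q])
    fix P assume P: "P \<in> set_partitions n k"
    obtain H where H: "H \<le> (n - k) div 2"
      "2 * int (cr_circular P) \<le> 2 * (int H * (int H - 2)) + (int n - int k) * (int n - int k - 1)"
      using cr_circular_le_shape[OF P k(2) refl] .
    have "int H * (int H - 2) \<le> 0"
      using H(1) a by (intro mult_nonneg_nonpos) auto
    then show "cr_circular P \<le> (n - k) choose 2" using H(2) eq by linarith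
  next
    have "cr_linear ?Q \<le> cr_circular ?Q"
      unfolding cr_linear_def cr_circular_def
      by (rule crossings_mono) (use finite_chords_partition[OF Q] in \<open>auto simp: chords_def\<close>)
    moreover have "(n - k) choose 2 \<le> cr_linear ?Q"
    proof (cases "n = k")
      case False
      then have "(int (n - k) - 1) * (2 * (int n - int k) - int (n - k)) \<le> 2 * int (cr_linear ?Q)"
        by (intro cr_linear_residue_partition_ge) (use k in auto)
      then have "(int n - int k) * (int n - int k - 1) \<le> 2 * int (cr_linear ?Q)"
        using k by (simp add: of_nat_diff algebra_simps)
      then show ?thesis using eq by linarith
    qed (simp add: choose_two)
    ultimately show "(n - k) choose 2 \<le> cr_circular ?Q" by simp
  qed
qed

theorem theorem1p12:
  fixes n k :: nat
  assumes "1 \<le> k" and "k \<le> n"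
  shows
    "(int k \<le> \<lfloor>real n / 2\<rfloor> \<longrightarrow>
        int (max_cr_linear n k) = (int k - 1) * int n - 3 * int (k choose 2)) \<and>
     (\<lceil>real n / 2\<rceil> \<le> int k \<longrightarrow>
        max_cr_linear n k = (n - k) choose 2) \<and>
     (real k \<le> real n / 3 \<longrightarrow>
        (let r = n mod k in
          max_cr_circular n k = 2 * (k choose 2) * (n div k) + 2 * (r choose 2) \<and>
          int (max_cr_circular n k) = (int k - 1) * int n - int r * (int k - int r))) \<and>
     ((real n / 3 \<le> real k \<and> real k < real n / 2) \<or>
      (real n / 2 \<le> real k \<and> int k \<le> int n - 6) \<longrightarrow>
        (let a = n - k in
          max_cr_circular n k =
            6 * ((a div 2) choose 2) + 2 * (a div 2) * of_bool (a mod 2 = 1))) \<and>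
     (int k \<ge> int n - 5 \<and> real k \<ge> real n / 2 \<longrightarrow>
        max_cr_circular n k = (n - k) choose 2)"
proof (intro conjI impI)
  assume "int k \<le> \<lfloor>real n / 2\<rfloor>"
  then have "2 * k \<le> n" by (simp add: le_floor_iff)
  then have "2 * int (max_cr_linear n k) = (int k - 1) * (2 * (int n - int k) - int k)"
    using assms by (intro max_cr_linear_eq) auto
  then show "int (max_cr_linear n k) = (int k - 1) * int n - 3 * int (k choose 2)"
    using twice_choose_two[of k] by (simp add: algebra_simps)
next
  assume "\<lceil>real n / 2\<rceil> \<le> int k"
  then have "n \<le> 2 * k" by (simp add: ceiling_le_iff)
  then have "2 * int (max_cr_linear n k) = (int (n - k) - 1) * (2 * (int n - int k) - int (n - k))"
    using assms by (intro max_cr_linear_eq) auto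
  also have "\<dots> = 2 * int ((n - k) choose 2)"
    using twice_choose_two[of "n - k"] assms by (simp add: of_nat_diff algebra_simps)
  finally show "max_cr_linear n k = (n - k) choose 2" by simp
next
  assume "real k \<le> real n / 3"
  then have k: "3 * k \<le> n" by linarith
  define r where "r = n mod k"
  have M: "int (max_cr_circular n k) = (int k - 1) * int n - int r * (int k - int r)"
    by (rule max_cr_circular_balanced[OF assms(1) k r_def])
  have n: "int n = int k * int (n div k) + int r"
    unfolding r_def by (simp flip: of_nat_mult of_nat_add)
  have "int (2 * (k choose 2) * (n div k) + 2 * (r choose 2))
      = int k * (int k - 1) * int (n div k) + int r * (int r - 1)"
    using twice_choose_two[of k] twice_choose_two[of r] by simp
  also have "\<dots> = int (max_cr_circular n k)"
    unfolding M using n by (simp add: algebra_simps)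
  finally have "max_cr_circular n k = 2 * (k choose 2) * (n div k) + 2 * (r choose 2)"
    by (simp only: of_nat_eq_iff)
  then show "let r = n mod k in
      max_cr_circular n k = 2 * (k choose 2) * (n div k) + 2 * (r choose 2) \<and>
      int (max_cr_circular n k) = (int k - 1) * int n - int r * (int k - int r)"
    using M by (simp only: Let_def r_def simp_thms)
next
  assume "(real n / 3 \<le> real k \<and> real k < real n / 2) \<or>
    (real n / 2 \<le> real k \<and> int k \<le> int n - 6)"
  then have c: "n \<le> 3 * k \<and> 2 * k < n \<or> n \<le> 2 * k \<and> k + 6 \<le> n" by linarith
  define a where "a = n - k"
  have "max_cr_circular n k = 6 * ((a div 2) choose 2) + 2 * (a div 2) * (a mod 2)"
  proof (rule max_cr_circular_triangles)
    show "n - k = 2 * (a div 2) + a mod 2" by (simp add: a_def)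
    show "2 * k < n \<or> 2 \<le> a div 2" using c by (auto simp: a_def)
  qed (use c in auto)
  moreover have "of_bool (a mod 2 = 1) = a mod 2" by (cases "a mod 2 = 0") auto
  ultimately show "let a = n - k in
      max_cr_circular n k = 6 * ((a div 2) choose 2) + 2 * (a div 2) * of_bool (a mod 2 = 1)"
    by (simp add: Let_def a_def)
next
  assume "int k \<ge> int n - 5 \<and> real k \<ge> real n / 2"
  then have "n - k \<le> 5" "n \<le> 2 * k" by linarith+
  then show "max_cr_circular n k = (n - k) choose 2"
    using max_cr_circular_small_excess assms by simp
qed

end
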